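(* For every integer $k$, there is a matroid $M\in\mathcal E_3$ containing neither $I_3$ nor $F_7$ as an induced restriction such that $\chi(M)\ge k$.
   Context: A simple binary matroid (here just "matroid") is a pair $M=(E,G)$, where $G$ is identified with $\mathbb F_2^n\setminus\{0\}$ for some $n\ge0$ and $E\subseteq G$; $\dim(M)=n$. A flat of $G$ is a set $V\setminus\{0\}$ with $V$ a subspace of $\mathbb F_2^n$; its dimension is $\dim V$. $M$ contains $N=(F',G')$ as an induced restriction if there is an injective linear map $\varphi:G'\to G$ (linear on the underlying vector spaces) with $\varphi(F')=E\cap\varphi(G')$. The critical number $\chi(M)$ is the smallest $k\ge0$ such that $G\setminus E$ contains a flat of dimension $n-k$. $\mathcal E_3$ is the class of matroids $M=(E,G)$ such that $|E\cap F|$ is even for every flat $F$ of $G$ of dimension at least $3$. $I_3$ is the $3$-dimensional matroid whose ground set is a set of $3$ linearly independent vectors; $F_7=(G,G)$ with $G=\mathbb F_2^3\setminus\{0\}$. *)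

theory Defs
  imports "HOL-Library.Z2" "Jordan_Normal_Form.VS_Connect"
begin

abbreviation F2 :: "nat \<Rightarrow> (bit, bit vec) module" where
  "F2 n \<equiv> module_vec TYPE(bit) n"

definition nonzero_vecs :: "nat \<Rightarrow> bit vec set" where
  "nonzero_vecs n = carrier_vec n - {0\<^sub>v n}"

text \<open>A matroid \<open>(E, G)\<close> is stored as its ground set \<open>E\<close> together with the number \<open>n\<close> for which
  \<open>G = nonzero_vecs n\<close>.\<close>

record matroid =
  points :: "bit vec set"
  mdim :: nat

definition ambient :: "matroid \<Rightarrow> bit vec set" where
  "ambient M = nonzero_vecs (mdim M)"

definition simple_binary_matroid :: "matroid \<Rightarrow> bool" where
  "simple_binary_matroid M \<longleftrightarrow> points M \<subseteq> ambient M"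

text \<open>\<open>flat_of_dim n d F\<close>: \<open>F\<close> is a flat of dimension \<open>d\<close> of \<open>nonzero_vecs n\<close>. The zero vector is
  not an element of \<open>F\<close>, so the dimension is that of the underlying subspace.\<close>

definition flat_of_dim :: "nat \<Rightarrow> nat \<Rightarrow> bit vec set \<Rightarrow> bool" where
  "flat_of_dim n d F \<longleftrightarrow>
     (\<exists>V. VectorSpace.subspace class_ring V (F2 n) \<and>
          vectorspace.dim class_ring ((F2 n)\<lparr>carrier := V\<rparr>) = d \<and>
          F = V - {0\<^sub>v n})"

definition contains_induced :: "matroid \<Rightarrow> matroid \<Rightarrow> bool" where
  "contains_induced M N \<longleftrightarrow>
     (\<exists>\<phi>. linear_map class_ring (F2 (mdim N)) (F2 (mdim M)) \<phi> \<and>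
          inj_on \<phi> (carrier_vec (mdim N)) \<and>
          \<phi> ` points N = points M \<inter> \<phi> ` ambient N)"

text \<open>The flat has dimension \<open>n - k\<close>, written \<open>d + k = n\<close> to avoid truncated subtraction; \<open>k = n\<close>
  always qualifies (empty flat), so the minimum exists.\<close>

definition critical_number :: "matroid \<Rightarrow> nat" where
  "critical_number M =
     (LEAST k. \<exists>d F. d + k = mdim M \<and> flat_of_dim (mdim M) d F \<and> F \<subseteq> ambient M - points M)"

definition \<E>\<^sub>3 :: "matroid set" where
  "\<E>\<^sub>3 = {M. simple_binary_matroid M \<and>
            (\<forall>d F. d \<ge> 3 \<longrightarrow> flat_of_dim (mdim M) d F \<longrightarrow> even (card (points M \<inter> F)))}"

text \<open>\<open>I\<^sub>3\<close> is determined up to isomorphism; the representative used here has the standard basis of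
  the 3-dimensional space as its ground set.\<close>

definition I\<^sub>3 :: matroid where
  "I\<^sub>3 = \<lparr>points = set (unit_vecs 3), mdim = 3\<rparr>"

definition F\<^sub>7 :: matroid where
  "F\<^sub>7 = \<lparr>points = nonzero_vecs 3, mdim = 3\<rparr>"

end

theory Submission
  imports Defs
begin

text \<open>
  Take for the ground set the points of \<open>\<bbbF>\<^sub>2\<^sup>2\<^sup>m\<close> at which the hyperbolic quadratic form
  \<open>q x = (\<Sum>i<m. x\<^sub>i x\<^sub>m\<^sub>+\<^sub>i)\<close> takes the value 1. Since \<open>q\<close> has degree 2, it sums to 0 over every subspace
  of dimension at least 3, so the matroid is in \<open>\<E>\<^sub>3\<close>; and \<open>I\<^sub>3\<close> and \<open>F\<^sub>7\<close> have an odd number of points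
  in a space of dimension 3, so neither is an induced restriction. A flat that avoids the ground set
  spans a totally singular subspace for \<open>q\<close>, and such a subspace has dimension at most \<open>m\<close>; so
  the critical number is at least \<open>m\<close>.
\<close>

section \<open>Cardinality and dimension over F_2\<close>

lemma (in vectorspace) card_carrier_eq_power_dim:
  assumes "finite (carrier V)"
  shows "card (carrier V) = card (carrier K) ^ dim"
proof -
  have "gen_set (carrier V)"
    using in_own_span[of "carrier V"] span_is_subset2[of "carrier V"] by auto
  then have "fin_dim"
    unfolding fin_dim_def using assms by auto
  then obtain A where A: "finite A" "basis A"
    using finite_basis_exists by auto
  then have AV: "A \<subseteq> carrier V"
    by (auto simp: basis_def)
  have ex1: "\<exists>!a. a \<in> A \<rightarrow>\<^sub>E carrier K \<and> lincomb a A = v" if "v \<in> carrier V" for v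
    using basis_criterion[OF A(1) AV] A(2) that by blast
  have closed: "lincomb a A \<in> carrier V" if "a \<in> A \<rightarrow>\<^sub>E carrier K" for a
    using that AV A(1) by (intro lincomb_closed) (auto simp: PiE_def)
  have "bij_betw (\<lambda>a. lincomb a A) (A \<rightarrow>\<^sub>E carrier K) (carrier V)"
    unfolding bij_betw_def
  proof
    show "inj_on (\<lambda>a. lincomb a A) (A \<rightarrow>\<^sub>E carrier K)"
      using ex1 closed by (intro inj_onI) metis
    show "(\<lambda>a. lincomb a A) ` (A \<rightarrow>\<^sub>E carrier K) = carrier V"
      using ex1 closed by blast
  qed
  then have "card (carrier V) = card (A \<rightarrow>\<^sub>E carrier K)"
    by (simp add: bij_betw_same_card)
  then show ?thesis
    using A dim_basis by (simp add: card_funcsetE)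
qed

text \<open>These two rules rewrite bit arithmetic to \<open>XOR\<close> and \<open>AND\<close>, where the ring lemmas no longer apply.\<close>

declare add_bit_eq_xor [simp del] mult_bit_eq_and [simp del]

lemma UNIV_bit: "(UNIV :: bit set) = {0, 1}"
  by (auto intro: bit.exhaust)

lemma card_UNIV_bit: "card (UNIV :: bit set) = 2"
  unfolding UNIV_bit by simp

lemma bit_add_self: "(a :: bit) + a = 0"
  by (cases a) auto

lemma even_bit_iff: "even (b :: bit) \<longleftrightarrow> b = 0"
  by (cases b) auto

lemma finite_carrier_vec_bit: "finite (carrier_vec n :: bit vec set)"
proof -
  have "carrier_vec n \<subseteq> vec_of_list ` {xs :: bit list. set xs \<subseteq> UNIV \<and> length xs = n}"
  proof
    fix x :: "bit vec" assume "x \<in> carrier_vec n"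
    then show "x \<in> vec_of_list ` {xs. set xs \<subseteq> UNIV \<and> length xs = n}"
      by (intro image_eqI[of _ _ "list_of_vec x"]) (auto simp: vec_list)
  qed
  moreover have "finite {xs :: bit list. set xs \<subseteq> UNIV \<and> length xs = n}"
    by (rule finite_lists_length_eq) (simp add: UNIV_bit)
  ultimately show ?thesis
    using finite_surj by blast
qed

lemma vectorspace_F2: "vectorspace class_ring (F2 n)"
proof -
  interpret vec_space "TYPE(bit)" n .
  show ?thesis ..
qed

text \<open>Converts dimension into cardinality, the form in which the counting arguments below use
  it.\<close>

lemma card_F2_subspace:
  assumes "VectorSpace.subspace class_ring V (F2 n)"
  shows "card V = 2 ^ vectorspace.dim class_ring ((F2 n)\<lparr>carrier := V\<rparr>)"
proof -
  interpret V: vectorspace class_ring "(F2 n)\<lparr>carrier := V\<rparr>"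
    using vectorspace.subspace_is_vs[OF vectorspace_F2 assms] .
  have "V \<subseteq> carrier_vec n"
    using submodule.subset[OF subspace.submod[OF assms]] by (simp add: module_vec_simps)
  then have "finite V"
    using finite_carrier_vec_bit finite_subset by blast
  then show ?thesis
    using V.card_carrier_eq_power_dim by (simp add: card_UNIV_bit)
qed

lemma card_carrier_vec_bit: "card (carrier_vec n :: bit vec set) = 2 ^ n"
proof -
  interpret vec_space "TYPE(bit)" n .
  show ?thesis
    using card_carrier_eq_power_dim finite_carrier_vec_bit dim_is_n
    by (simp add: card_UNIV_bit)
qed

lemma F2_subspaceD:
  assumes "VectorSpace.subspace class_ring V (F2 n)"
  shows "V \<subseteq> carrier_vec n" and "0\<^sub>v n \<in> V"
    and "\<And>x y. x \<in> V \<Longrightarrow> y \<in> V \<Longrightarrow> x + y \<in> V"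
  using subspace.submod[OF assms] unfolding submodule_def by (auto simp: module_vec_simps)

lemma add_bit_vec_cancel:
  fixes x a :: "bit vec"
  assumes "x \<in> carrier_vec n" "a \<in> carrier_vec n"
  shows "x + a + a = x"
  using assms by (intro eq_vecI) (auto simp: add.assoc bit_add_self)

text \<open>At a coordinate \<open>j\<close> where \<open>a\<close> is 1, translation by
  \<open>a\<close> flips the bit, so it exchanges the halves \<open>T0\<close> and \<open>T1\<close>
  of \<open>T\<close>.\<close>

lemma even_card_if_translation_invariant:
  fixes T :: "bit vec set"
  assumes T: "T \<subseteq> carrier_vec n" and a: "a \<in> carrier_vec n" "a \<noteq> 0\<^sub>v n"
    and inv: "\<And>x. x \<in> T \<Longrightarrow> x + a \<in> T"
  shows "even (card T)"
proof -
  obtain j where j: "j < n" "a $ j = 1"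
    using a by (metis bit_not_zero_iff carrier_vecD eq_vecI index_zero_vec)
  define T0 where "T0 = {x \<in> T. x $ j = 0}"
  define T1 where "T1 = {x \<in> T. x $ j = 1}"
  have fin: "finite T"
    using T finite_carrier_vec_bit finite_subset by blast
  have "bij_betw (\<lambda>x. x + a) T0 T1"
    using T a j inv by (intro bij_betwI[where g = "\<lambda>x. x + a"])
      (auto simp: T0_def T1_def add_bit_vec_cancel[OF _ a(1)] subset_iff)
  then have "card T0 = card T1"
    by (rule bij_betw_same_card)
  moreover have "T = T0 \<union> T1" "T0 \<inter> T1 = {}"
    by (auto simp: T0_def T1_def)
  ultimately have "card T = 2 * card T0"
    using fin by (metis card_Un_disjoint finite_Un mult_2)
  then show ?thesis by simp
qed

section \<open>The hyperbolic quadratic form and the parity of its count on subspaces\<close>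

definition hyp_form :: "nat \<Rightarrow> bit vec \<Rightarrow> bit" where
  "hyp_form m x = (\<Sum>i<m. x $ i * x $ (m + i))"

text \<open>The standard symplectic form, which is the polarization of
  \<open>hyp_form\<close>.\<close>

definition hyp_polar :: "nat \<Rightarrow> bit vec \<Rightarrow> bit vec \<Rightarrow> bit" where
  "hyp_polar m x y = (\<Sum>i<m. x $ i * y $ (m + i) + x $ (m + i) * y $ i)"

definition hyp_matroid :: "nat \<Rightarrow> matroid" where
  "hyp_matroid m = \<lparr>points = {x \<in> carrier_vec (2 * m). hyp_form m x = 1}, mdim = 2 * m\<rparr>"

lemma hyp_form_add:
  assumes "x \<in> carrier_vec (2 * m)" "y \<in> carrier_vec (2 * m)"
  shows "hyp_form m (x + y) = hyp_form m x + hyp_form m y + hyp_polar m x y"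
  using assms unfolding hyp_form_def hyp_polar_def sum.distrib[symmetric]
  by (intro sum.cong) (auto simp: algebra_simps)

lemma hyp_polar_add_left:
  assumes "x \<in> carrier_vec (2 * m)" "y \<in> carrier_vec (2 * m)"
  shows "hyp_polar m (x + y) z = hyp_polar m x z + hyp_polar m y z"
  using assms unfolding hyp_polar_def sum.distrib[symmetric]
  by (intro sum.cong) (auto simp: algebra_simps)

lemma hyp_polar_commute: "hyp_polar m x y = hyp_polar m y x"
  unfolding hyp_polar_def by (intro sum.cong) (auto simp: algebra_simps)

lemma hyp_polar_nondegenerate:
  assumes x: "x \<in> carrier_vec (2 * m)" "x \<noteq> 0\<^sub>v (2 * m)"
  obtains e where "e \<in> carrier_vec (2 * m)" "hyp_polar m x e = 1"
proof -
  obtain j where j: "j < 2 * m" "x $ j = 1"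
    using x by (metis bit_not_zero_iff carrier_vecD eq_vecI index_zero_vec)
  \<comment> \<open>\<open>j'\<close> is the index that the polar form pairs with \<open>j\<close>,
    so pairing \<open>x\<close> with the unit vector at \<open>j'\<close> returns
    \<open>x $ j\<close>.\<close>
  define j' where "j' = (if j < m then m + j else j - m)"
  define e :: "bit vec" where "e = unit_vec (2 * m) j'"
  have "hyp_polar m x e = (\<Sum>i<m. if i = (if j < m then j else j - m) then 1 else 0)"
    unfolding hyp_polar_def
    using j by (intro sum.cong refl) (auto simp: e_def j'_def)
  also have "\<dots> = 1"
    using j by (subst sum.delta) auto
  finally show ?thesis
    using that[of e] by (simp add: e_def)
qed

text \<open>Modulo 2 the count is the sum of the form over \<open>V\<close>; exchanging sums reduces
  the claim to one monomial at a time.\<close>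

lemma even_card_hyp_form_eq_1:
  assumes V: "V \<subseteq> carrier_vec (2 * m)" and add: "\<And>x y. x \<in> V \<Longrightarrow> y \<in> V \<Longrightarrow> x + y \<in> V"
    and card: "card V > 4"
  shows "even (card {x \<in> V. hyp_form m x = 1})"
proof -
  have fin: "finite V"
    using card by (metis card.infinite not_less_zero)
  have even_i: "even (card {x \<in> V. x $ i * x $ (m + i) = 1})" if i: "i < m" for i
  proof -
    let ?f = "\<lambda>x :: bit vec. (x $ i, x $ (m + i))"
    \<comment> \<open>Two coordinates have only 4 joint values, so two distinct vectors of
      \<open>V\<close> agree in both. Their sum is nonzero, and translation by it preserves the
      monomial.\<close>
    have "\<not> inj_on ?f V"
    proof
      assume "inj_on ?f V"
      moreover have "?f ` V \<subseteq> {0, 1} \<times> {0, 1}" by auto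
      ultimately have "card V \<le> card ({0, 1 :: bit} \<times> {0, 1 :: bit})"
        by (intro card_inj_on_le[of ?f]) auto
      then show False using card by (simp add: card_cartesian_product)
    qed
    then obtain x y where xy: "x \<in> V" "y \<in> V" "x \<noteq> y" "x $ i = y $ i" "x $ (m + i) = y $ (m + i)"
      by (auto simp: inj_on_def)
    let ?a = "x + y"
    have c: "x \<in> carrier_vec (2 * m)" "y \<in> carrier_vec (2 * m)"
      using xy V by auto
    have "?a \<noteq> 0\<^sub>v (2 * m)"
      using xy(3) add_bit_vec_cancel[OF c] left_zero_vec[OF c(2)] by metis
    moreover have "?a $ i = 0" "?a $ (m + i) = 0"
      using xy c i by (auto simp: bit_add_self)
    ultimately show ?thesis
      using V c i add[OF _ add[OF xy(1,2)]]
      by (intro even_card_if_translation_invariant[of _ "2 * m" ?a]) (auto simp: subset_iff)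
  qed
  \<comment> \<open>\<open>of_nat\<close> into \<open>bit\<close> is reduction modulo 2.\<close>
  have card_bit: "of_nat (card {x \<in> V. f x = 1}) = (\<Sum>x\<in>V. f x)" for f :: "bit vec \<Rightarrow> bit"
  proof -
    have "(\<Sum>x\<in>V. f x) = (\<Sum>x\<in>V. if f x = 1 then 1 else 0)"
      by (intro sum.cong) auto
    also have "\<dots> = of_nat (card {x \<in> V. f x = 1})"
      using fin by (simp add: sum.inter_filter[symmetric])
    finally show ?thesis ..
  qed
  have "of_nat (card {x \<in> V. hyp_form m x = 1}) = (\<Sum>x\<in>V. \<Sum>i<m. x $ i * x $ (m + i))"
    by (simp add: card_bit hyp_form_def)
  also have "\<dots> = (\<Sum>i<m. of_nat (card {x \<in> V. x $ i * x $ (m + i) = 1}))"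
    by (subst sum.swap) (simp only: card_bit)
  also have "\<dots> = (0 :: bit)"
  proof (intro sum.neutral ballI)
    fix i assume "i \<in> {..<m}"
    then show "of_nat (card {x \<in> V. x $ i * x $ (m + i) = 1}) = (0 :: bit)"
      using even_i[of i] even_of_nat even_bit_iff by (metis lessThan_iff)
  qed
  finally show ?thesis
    by (metis even_of_nat even_zero)
qed

section \<open>Character sums and totally singular subspaces\<close>

definition bit_sign :: "bit \<Rightarrow> int" where
  "bit_sign b = (if b = 0 then 1 else - 1)"

lemma bit_sign_add_1: "bit_sign (b + 1) = - bit_sign b"
  by (cases b) (auto simp: bit_sign_def)

text \<open>\<open>bit_sign\<close> is the nontrivial additive character of F_2. Translation by
  \<open>e\<close> permutes \<open>S\<close> and negates every term, so the sum is its own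
  negative.\<close>

lemma sum_bit_sign_eq_0:
  fixes h :: "bit vec \<Rightarrow> bit"
  assumes S: "S \<subseteq> carrier_vec n" and e: "e \<in> carrier_vec n"
    and inv: "\<And>x. x \<in> S \<Longrightarrow> x + e \<in> S" and h: "\<And>x. x \<in> S \<Longrightarrow> h (x + e) = h x + 1"
  shows "(\<Sum>x\<in>S. bit_sign (h x)) = 0"
proof -
  have "(\<Sum>x\<in>S. bit_sign (h x)) = (\<Sum>x\<in>S. bit_sign (h (x + e)))"
    using S e inv
    by (intro sum.reindex_bij_witness[of _ "\<lambda>x. x + e" "\<lambda>x. x + e"])
      (auto simp: add_bit_vec_cancel[OF _ e] subset_iff)
  also have "\<dots> = - (\<Sum>x\<in>S. bit_sign (h x))"
    by (simp add: h bit_sign_add_1 sum_negf)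
  finally show ?thesis by simp
qed

text \<open>The signs \<open>(-1) ^ B(a, y)\<close> are summed over \<open>a \<in> V\<close> and all \<open>y\<close>, where \<open>B\<close> is the polar form.
  Only \<open>a = 0\<close> contributes, so the total is \<open>2\<^sup>2\<^sup>m\<close>; on the other hand the sum over \<open>a\<close> is nonnegative
  for every \<open>y\<close> and equals \<open>|V|\<close> for \<open>y \<in> V\<close>.\<close>

lemma card_totally_singular_le:
  assumes V: "V \<subseteq> carrier_vec (2 * m)" and zero: "0\<^sub>v (2 * m) \<in> V"
    and add: "\<And>x y. x \<in> V \<Longrightarrow> y \<in> V \<Longrightarrow> x + y \<in> V"
    and sing: "\<And>x. x \<in> V \<Longrightarrow> hyp_form m x = 0"
  shows "card V \<le> 2 ^ m"
proof -
  let ?G = "carrier_vec (2 * m) :: bit vec set"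
  let ?s = "\<lambda>a y. bit_sign (hyp_polar m a y)"
  have finG: "finite ?G" by (rule finite_carrier_vec_bit)
  have finV: "finite V" using V finG finite_subset by blast
  \<comment> \<open>By polarization, the form vanishing at \<open>a\<close>, \<open>y\<close> and
    \<open>a + y\<close> makes \<open>a\<close> and \<open>y\<close> orthogonal.\<close>
  have polar0: "hyp_polar m a y = 0" if "a \<in> V" "y \<in> V" for a y
    using hyp_form_add[of a m y] sing add that V by (auto simp: subset_iff)
  have inner_y: "(\<Sum>y\<in>?G. ?s a y) = (if a = 0\<^sub>v (2 * m) then 2 ^ (2 * m) else 0)" if "a \<in> V" for a
  proof (cases "a = 0\<^sub>v (2 * m)")
    case True
    then have "hyp_polar m a y = 0" for y
      by (simp add: hyp_polar_def)
    then show ?thesis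
      using True by (simp add: bit_sign_def card_carrier_vec_bit)
  next
    case False
    then obtain e where e: "e \<in> ?G" "hyp_polar m a e = 1"
      using hyp_polar_nondegenerate[of a m] \<open>a \<in> V\<close> V by blast
    have "hyp_polar m a (y + e) = hyp_polar m a y + 1" if "y \<in> ?G" for y
      using hyp_polar_add_left[OF that e(1)] e(2) by (simp add: hyp_polar_commute[of m a])
    then show ?thesis
      using False e by (subst sum_bit_sign_eq_0[of _ "2 * m" e]) auto
  qed
  \<comment> \<open>Either some vector of \<open>V\<close> pairs to 1 with \<open>y\<close> and the
    sum cancels, or all its signs are 1.\<close>
  have inner_a: "(\<Sum>a\<in>V. ?s a y) \<ge> 0" if "y \<in> ?G" for y
  proof (cases "\<exists>e\<in>V. hyp_polar m e y = 1")
    case True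
    then obtain e where e: "e \<in> V" "hyp_polar m e y = 1" by auto
    have "hyp_polar m (a + e) y = hyp_polar m a y + 1" if "a \<in> V" for a
      using hyp_polar_add_left[of a m e y] V e that by auto
    then show ?thesis
      using V e add by (subst sum_bit_sign_eq_0[of _ "2 * m" e]) auto
  next
    case False
    then show ?thesis
      by (intro sum_nonneg) (auto simp: bit_sign_def)
  qed
  have "int (card V * card V) = (\<Sum>y\<in>V. \<Sum>a\<in>V. ?s a y)"
    by (simp add: polar0 bit_sign_def)
  also have "\<dots> \<le> (\<Sum>y\<in>?G. \<Sum>a\<in>V. ?s a y)"
    using inner_a V finG by (intro sum_mono2) auto
  also have "\<dots> = (\<Sum>a\<in>V. \<Sum>y\<in>?G. ?s a y)"
    by (rule sum.swap)
  also have "\<dots> = (\<Sum>a\<in>V. if a = 0\<^sub>v (2 * m) then 2 ^ (2 * m) else 0)"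
    by (intro sum.cong inner_y) auto
  also have "\<dots> = 2 ^ (2 * m)"
    using zero finV by simp
  finally have "int ((card V)\<^sup>2) \<le> int ((2 ^ m)\<^sup>2)"
    by (simp add: power2_eq_square flip: power_add mult_2)
  then have "(card V)\<^sup>2 \<le> (2 ^ m)\<^sup>2"
    by (simp only: of_nat_le_iff)
  then show ?thesis
    by (rule power2_le_imp_le) simp
qed

section \<open>Membership in \<open>\<E>\<^sub>3\<close> and the excluded induced
  restrictions\<close>

lemma hyp_form_zero: "hyp_form m (0\<^sub>v (2 * m)) = 0"
  by (simp add: hyp_form_def)

text \<open>The form vanishes at 0, so deleting 0 leaves the count unchanged. Bounding the size of
  \<open>V\<close> instead of its dimension lets this serve both flats and images of
  embeddings.\<close>

lemma even_card_hyp_matroid_Int: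
  assumes V: "V \<subseteq> carrier_vec (2 * m)" and add: "\<And>x y. x \<in> V \<Longrightarrow> y \<in> V \<Longrightarrow> x + y \<in> V"
    and card: "card V > 4"
  shows "even (card (points (hyp_matroid m) \<inter> (V - {0\<^sub>v (2 * m)})))"
proof -
  have "points (hyp_matroid m) \<inter> (V - {0\<^sub>v (2 * m)}) = {x \<in> V. hyp_form m x = 1}"
    using V hyp_form_zero[of m] by (auto simp: hyp_matroid_def)
  then show ?thesis
    using even_card_hyp_form_eq_1[OF assms] by simp
qed

lemma hyp_matroid_in_E3: "hyp_matroid m \<in> \<E>\<^sub>3"
proof -
  have "simple_binary_matroid (hyp_matroid m)"
    using hyp_form_zero[of m]
    by (auto simp: simple_binary_matroid_def ambient_def nonzero_vecs_def hyp_matroid_def)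
  moreover have "even (card (points (hyp_matroid m) \<inter> F))"
    if d: "d \<ge> 3" and F: "flat_of_dim (2 * m) d F" for d F
  proof -
    from F obtain V where V: "VectorSpace.subspace class_ring V (F2 (2 * m))"
      "vectorspace.dim class_ring ((F2 (2 * m))\<lparr>carrier := V\<rparr>) = d" "F = V - {0\<^sub>v (2 * m)}"
      by (auto simp: flat_of_dim_def)
    \<comment> \<open>Dimension 3 is the least for which a subspace has more than 4 vectors.\<close>
    have "(2 :: nat) ^ 3 \<le> 2 ^ d"
      using d by (intro power_increasing) auto
    then have "card V > 4"
      using card_F2_subspace[OF V(1)] V(2) by simp
    then show ?thesis
      unfolding V(3) using F2_subspaceD[OF V(1)] by (intro even_card_hyp_matroid_Int) auto
  qed
  ultimately show ?thesis
    by (simp add: \<E>\<^sub>3_def) (simp add: hyp_matroid_def)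
qed

text \<open>An embedding maps the ambient space of \<open>N\<close> onto a flat of dimension at
  least 3, which meets the matroid in an even number of points; by injectivity that number is the
  size of \<open>points N\<close>.\<close>

lemma hyp_matroid_not_contains_odd:
  assumes N: "points N \<subseteq> ambient N" "mdim N \<ge> 3" "odd (card (points N))"
  shows "\<not> contains_induced (hyp_matroid m) N"
proof
  let ?d = "mdim N"
  assume "contains_induced (hyp_matroid m) N"
  then obtain \<phi> where lin: "linear_map class_ring (F2 ?d) (F2 (2 * m)) \<phi>"
    and inj: "inj_on \<phi> (carrier_vec ?d)"
    and eq: "\<phi> ` points N = points (hyp_matroid m) \<inter> \<phi> ` ambient N"
    by (auto simp: contains_induced_def hyp_matroid_def)
  interpret linear_map class_ring "F2 ?d" "F2 (2 * m)" \<phi> by (rule lin)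
  let ?V = "\<phi> ` carrier_vec ?d"
  have V: "VectorSpace.subspace class_ring ?V (F2 (2 * m))"
    using imT_is_subspace by (simp add: im_def module_vec_simps)
  have "card ?V = 2 ^ ?d"
    using inj by (simp add: card_image card_carrier_vec_bit)
  moreover have "(2 :: nat) ^ 3 \<le> 2 ^ ?d"
    using N(2) by (intro power_increasing) auto
  ultimately have "card ?V > 4" by simp
  then have "even (card (points (hyp_matroid m) \<inter> (?V - {0\<^sub>v (2 * m)})))"
    using F2_subspaceD[OF V] by (intro even_card_hyp_matroid_Int) auto
  moreover have "\<phi> ` ambient N = ?V - {0\<^sub>v (2 * m)}"
  proof -
    have "\<phi> (0\<^sub>v ?d) = 0\<^sub>v (2 * m)"
      using T0_is_0 by (simp add: module_vec_simps)
    then show ?thesis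
      unfolding ambient_def nonzero_vecs_def
      using inj_on_image_set_diff[OF inj, of "carrier_vec ?d" "{0\<^sub>v ?d}"] by simp
  qed
  ultimately have "even (card (\<phi> ` points N))"
    using eq by simp
  moreover have "card (\<phi> ` points N) = card (points N)"
    using N(1) inj by (intro card_image) (auto simp: ambient_def nonzero_vecs_def inj_on_def)
  ultimately show False using N(3) by simp
qed

lemma hyp_matroid_not_contains_I3: "\<not> contains_induced (hyp_matroid m) I\<^sub>3"
proof (rule hyp_matroid_not_contains_odd)
  show "points I\<^sub>3 \<subseteq> ambient I\<^sub>3"
    by (auto simp: I\<^sub>3_def ambient_def nonzero_vecs_def unit_vecs_def)
  have "card (set (unit_vecs 3 :: bit vec list)) = 3"
    by (subst distinct_card[OF vec_space.unit_vecs_distinct]) (simp add: unit_vecs_def)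
  then show "odd (card (points I\<^sub>3))"
    by (simp add: I\<^sub>3_def)
qed (simp add: I\<^sub>3_def)

lemma hyp_matroid_not_contains_F7: "\<not> contains_induced (hyp_matroid m) F\<^sub>7"
proof (rule hyp_matroid_not_contains_odd)
  show "odd (card (points F\<^sub>7))"
    by (simp add: F\<^sub>7_def nonzero_vecs_def card_Diff_singleton card_carrier_vec_bit)
qed (simp_all add: F\<^sub>7_def ambient_def)

section \<open>The critical number\<close>

lemma critical_number_attained:
  assumes "simple_binary_matroid M"
  shows "\<exists>d F. d + critical_number M = mdim M \<and> flat_of_dim (mdim M) d F \<and>
    F \<subseteq> ambient M - points M"
proof -
  let ?n = "mdim M"
  interpret vec_space "TYPE(bit)" ?n .
  have sub: "VectorSpace.subspace class_ring {0\<^sub>v ?n} (F2 ?n)"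
    by (intro subspace.intro submodule.intro vectorspace_F2 vectorspace.axioms(1)[OF vectorspace_F2])
      (auto simp: module_vec_simps)
  \<comment> \<open>The dimension of the zero subspace is read off from its cardinality 1.\<close>
  have "(2 :: nat) ^ vectorspace.dim class_ring ((F2 ?n)\<lparr>carrier := {0\<^sub>v ?n}\<rparr>) = 2 ^ 0"
    unfolding card_F2_subspace[OF sub, symmetric] by simp
  then have "vectorspace.dim class_ring ((F2 ?n)\<lparr>carrier := {0\<^sub>v ?n}\<rparr>) = 0"
    by (rule power_inject_exp[THEN iffD1, rotated]) simp
  then have "flat_of_dim ?n 0 {}"
    unfolding flat_of_dim_def using sub by blast
  \<comment> \<open>The empty flat makes \<open>?n\<close> an admissible value, so the
    \<open>LEAST\<close> is attained.\<close>
  then have "\<exists>d F. d + ?n = ?n \<and> flat_of_dim ?n d F \<and> F \<subseteq> ambient M - points M"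
    by auto
  then show ?thesis
    unfolding critical_number_def by (rule LeastI)
qed

lemma critical_number_hyp_matroid_ge: "m \<le> critical_number (hyp_matroid m)"
proof -
  have M: "simple_binary_matroid (hyp_matroid m)" "mdim (hyp_matroid m) = 2 * m"
    using hyp_matroid_in_E3[of m] by (auto simp: \<E>\<^sub>3_def hyp_matroid_def)
  obtain d F where d: "d + critical_number (hyp_matroid m) = 2 * m"
    and F: "flat_of_dim (2 * m) d F" "F \<subseteq> ambient (hyp_matroid m) - points (hyp_matroid m)"
    using critical_number_attained[OF M(1)] M(2) by auto
  from F(1) obtain V where V: "VectorSpace.subspace class_ring V (F2 (2 * m))"
    "vectorspace.dim class_ring ((F2 (2 * m))\<lparr>carrier := V\<rparr>) = d" "F = V - {0\<^sub>v (2 * m)}"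
    by (auto simp: flat_of_dim_def)
  have "hyp_form m x = 0" if "x \<in> V" for x
  proof (cases "x = 0\<^sub>v (2 * m)")
    case False
    then have "x \<notin> points (hyp_matroid m)"
      using that F(2) V(3) by blast
    then show ?thesis
      using that F2_subspaceD(1)[OF V(1)] by (simp add: hyp_matroid_def subset_iff)
  qed (simp add: hyp_form_zero)
  then have "card V \<le> 2 ^ m"
    using F2_subspaceD[OF V(1)] by (intro card_totally_singular_le) auto
  then have "(2 :: nat) ^ d \<le> 2 ^ m"
    using card_F2_subspace[OF V(1)] V(2) by simp
  then have "d \<le> m"
    by simp
  then show ?thesis using d by simp
qed

theorem theorem1p3:
  fixes k :: int
  shows "\<exists>M. M \<in> \<E>\<^sub>3 \<and> \<not> contains_induced M I\<^sub>3 \<and> \<not> contains_induced M F\<^sub>7 \<and>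
             int (critical_number M) \<ge> k"
  using hyp_matroid_in_E3 hyp_matroid_not_contains_I3 hyp_matroid_not_contains_F7
    critical_number_hyp_matroid_ge[of "nat k"]
  \<comment> \<open>For negative \<open>k\<close>, \<open>nat k\<close> is 0 and the bound is
    trivial.\<close>
  by (intro exI[of _ "hyp_matroid (nat k)"]) auto

end
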